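(* Let $n\ge2$. In error coordinates, $$\mathfrak C_n=\{(E_c(H))_{H\subseteq[n],\,|H|\ge2}:c\in\mathcal C_n\}.$$ Equivalently, the set of success profiles of lists of $n$ classical states is precisely $\{\theta_c:c\in\mathcal C_n\}$. In particular, $\mathfrak C_n$ is a rational polytope.
   Context: $[n]=\{1,\ldots,n\}$. For probability distributions (classical states) $p_1,\ldots,p_n$ in a simplex $\Delta_m=\{p\in\mathbb R^m:p_j\ge0,\ \sum_jp_j=1\}$ and nonempty $H\subseteq[n]$, the success profile is $D(H)=\max\sum_{i\in H}e_i(p_i)$, the maximum over families $(e_i)_{i\in H}$ of nonnegative affine functions on $\Delta_m$ with $\sum_{i\in H}e_i=1$, and the error profile is $F(H)=|H|-D(H)$; $D(\varnothing)=F(\varnothing)=0$. The classical region $\mathfrak C_n\subseteq\mathbb R^{2^n-n-1}$ is the set of all vectors $(F(H))_{H\subseteq[n],|H|\ge2}$ arising in this way for some $m\ge1$ and some $p_1,\ldots,p_n\in\Delta_m$ (no closure is taken). The coefficient polytope is $\mathcal C_n=\{(c_B)_{\varnothing\ne B\subseteq[n]}: c_B\ge0,\ \sum_{B\ni i}c_B=1\text{ for all }i\in[n]\}$. For $c\in\mathcal C_n$ and $H\subseteq[n]$, $\theta_c(H)=\sum_{B:\,B\cap H\ne\varnothing}c_B$ and $E_c(H)=|H|-\theta_c(H)$. A rational polytope is a bounded polyhedron defined by finitely many linear inequalities with rational coefficients. *)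

theory Defs
  imports "HOL-Analysis.Analysis"
begin

text \<open>
  The dimensions below vary inside the statement, so for a finite index set \<open>I\<close> the space of
  real vectors indexed by \<open>I\<close> is rendered as \<^term>\<open>extensional I :: ('i \<Rightarrow> real) set\<close>, whose
  elements are determined by their values on \<open>I\<close>.
\<close>

definition prob_simplex :: "nat \<Rightarrow> (nat \<Rightarrow> real) set" where
  "prob_simplex m =
    {p \<in> extensional {1..m}. (\<forall>j\<in>{1..m}. 0 \<le> p j) \<and> (\<Sum>j=1..m. p j) = 1}"

definition affine_on_simplex :: "nat \<Rightarrow> ((nat \<Rightarrow> real) \<Rightarrow> real) \<Rightarrow> bool" where
  "affine_on_simplex m f \<longleftrightarrow>
    (\<forall>x\<in>prob_simplex m. \<forall>y\<in>prob_simplex m. \<forall>t\<in>{0..1::real}.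
      f (\<lambda>j\<in>{1..m}. (1 - t) * x j + t * y j) = (1 - t) * f x + t * f y)"

definition measurement :: "nat \<Rightarrow> nat set \<Rightarrow> (nat \<Rightarrow> (nat \<Rightarrow> real) \<Rightarrow> real) \<Rightarrow> bool" where
  "measurement m H e \<longleftrightarrow>
    (\<forall>i\<in>H. affine_on_simplex m (e i) \<and> (\<forall>x\<in>prob_simplex m. 0 \<le> e i x)) \<and>
    (\<forall>x\<in>prob_simplex m. (\<Sum>i\<in>H. e i x) = 1)"

text \<open>
  On the type \<^typ>\<open>real\<close>, \<open>GREATEST\<close> is the maximum of a set of values (not a supremum).  The case
  of empty \<open>H\<close> is a separate convention, since there is no measurement with no outcomes.
\<close>

definition success_profile :: "nat \<Rightarrow> (nat \<Rightarrow> nat \<Rightarrow> real) \<Rightarrow> nat set \<Rightarrow> real" where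
  "success_profile m p H =
    (if H = {} then 0
     else (GREATEST s. \<exists>e. measurement m H e \<and> s = (\<Sum>i\<in>H. e i (p i))))"

definition error_profile :: "nat \<Rightarrow> (nat \<Rightarrow> nat \<Rightarrow> real) \<Rightarrow> nat set \<Rightarrow> real" where
  "error_profile m p H = real (card H) - success_profile m p H"

definition error_coords :: "nat \<Rightarrow> nat set set" where
  "error_coords n = {H. H \<subseteq> {1..n} \<and> 2 \<le> card H}"

definition classical_region :: "nat \<Rightarrow> (nat set \<Rightarrow> real) set" where
  "classical_region n =
    {(\<lambda>H\<in>error_coords n. error_profile m p H) | m p.
      1 \<le> m \<and> (\<forall>i\<in>{1..n}. p i \<in> prob_simplex m)}"

definition classical_success_profiles :: "nat \<Rightarrow> (nat set \<Rightarrow> real) set" where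
  "classical_success_profiles n =
    {(\<lambda>H\<in>Pow {1..n}. success_profile m p H) | m p.
      1 \<le> m \<and> (\<forall>i\<in>{1..n}. p i \<in> prob_simplex m)}"

definition coefficient_polytope :: "nat \<Rightarrow> (nat set \<Rightarrow> real) set" where
  "coefficient_polytope n =
    {c \<in> extensional (Pow {1..n} - {{}}).
      (\<forall>B\<in>Pow {1..n} - {{}}. 0 \<le> c B) \<and>
      (\<forall>i\<in>{1..n}. (\<Sum>B | B \<subseteq> {1..n} \<and> i \<in> B. c B) = 1)}"

definition theta :: "nat \<Rightarrow> (nat set \<Rightarrow> real) \<Rightarrow> nat set \<Rightarrow> real" where
  "theta n c H = (\<Sum>B | B \<subseteq> {1..n} \<and> B \<inter> H \<noteq> {}. c B)"

definition coeff_error :: "nat \<Rightarrow> (nat set \<Rightarrow> real) \<Rightarrow> nat set \<Rightarrow> real" where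
  "coeff_error n c H = real (card H) - theta n c H"

text \<open>
  Each pair \<open>(a, b)\<close> in \<open>A\<close> encodes the inequality with coefficient vector \<open>a\<close> and right-hand
  side \<open>b\<close>; only the values of \<open>a\<close> on \<open>I\<close> matter.
\<close>

definition rational_polytope :: "'i set \<Rightarrow> ('i \<Rightarrow> real) set \<Rightarrow> bool" where
  "rational_polytope I S \<longleftrightarrow>
    finite I \<and>
    (\<forall>i\<in>I. bounded ((\<lambda>x. x i) ` S)) \<and>
    (\<exists>A :: (('i \<Rightarrow> rat) \<times> rat) set. finite A \<and>
      S = {x \<in> extensional I. \<forall>(a, b)\<in>A. (\<Sum>i\<in>I. of_rat (a i) * x i) \<le> of_rat b})"

end

theory Submission
  imports Defs
begin

text \<open>
  An affine function on a simplex is determined by its values at the vertices, so the success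
  profile of \<open>p\<close> at \<open>H\<close> is \<open>\<Sum>j. Max {p i j | i \<in> H}\<close>.  For fixed \<open>j\<close>, the layer-cake decomposition
  writes this maximum as the sum, over the sets \<open>B\<close> meeting \<open>H\<close>, of the length of
  \<open>{t \<ge> 0. {i. t < p i j} = B}\<close>; summing these lengths over \<open>j\<close> gives \<open>c B\<close>.  Conversely, \<open>c\<close> is
  realised on the simplex whose vertices are the nonempty sets \<open>B\<close>, by giving \<open>p i\<close> the mass
  \<open>c B\<close> at each \<open>B\<close> containing \<open>i\<close>.  Finally, Moebius inversion recovers \<open>c\<close> from the error
  coordinates through integral affine functions, so the image of the coefficient polytope is cut
  out by the inequalities \<open>0 \<le> c B\<close>, and no projection of polyhedra is needed.
\<close>

section \<open>Measurements on a simplex and the success profile as a sum of maxima\<close>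

definition vertex :: "nat \<Rightarrow> nat \<Rightarrow> nat \<Rightarrow> real" where
  "vertex m k = (\<lambda>j\<in>{1..m}. if j = k then 1 else 0)"

lemma vertex_in_prob_simplex:
  assumes "k \<in> {1..m}"
  shows "vertex m k \<in> prob_simplex m"
  using assms by (simp add: vertex_def prob_simplex_def)

text \<open>Induction on a set \<open>S\<close> containing the support of \<open>x\<close>:
  splitting off one vertex \<open>k\<close> writes \<open>x\<close> as a two-point convex
  combination of \<open>vertex m k\<close> and the renormalised rest, which is supported on a
  smaller set. Thus affinity along segments yields the full vertex expansion.\<close>

lemma affine_on_simplex_expand_aux:
  assumes f: "affine_on_simplex m f"
    and "finite S" "S \<subseteq> {1..m}" "x \<in> prob_simplex m" "\<And>j. j \<in> {1..m} - S \<Longrightarrow> x j = 0"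
  shows "f x = (\<Sum>j\<in>S. x j * f (vertex m j))"
  using assms(2-)
proof (induction S arbitrary: x rule: finite_induct)
  case empty
  then have "(\<Sum>j=1..m. x j) = 0" by (intro sum.neutral) auto
  with empty show ?case by (simp add: prob_simplex_def)
next
  case (insert k S)
  have k: "k \<in> {1..m}" and S: "S \<subseteq> {1..m}" using insert.prems by auto
  have x0: "\<And>j. j \<in> {1..m} \<Longrightarrow> 0 \<le> x j" and x_ext: "x \<in> extensional {1..m}"
    using insert.prems(2) by (auto simp: prob_simplex_def)
  have "(\<Sum>j=1..m. x j) = (\<Sum>j\<in>insert k S. x j)"
    by (rule sum.mono_neutral_right) (use insert.prems in auto)
  then have tot: "x k + (\<Sum>j\<in>S. x j) = 1"
    using insert.prems(2) insert.hyps by (simp add: prob_simplex_def)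
  show ?case
  \<comment> \<open>If all mass sits at \<open>k\<close>, the rest cannot be renormalised, but then
    \<open>x\<close> is the vertex itself.\<close>
  proof (cases "x k = 1")
    case True
    then have "(\<Sum>j\<in>S. x j) = 0" using tot by simp
    then have z: "\<And>j. j \<in> S \<Longrightarrow> x j = 0"
      using S x0 insert.hyps(1) by (subst (asm) sum_nonneg_eq_0_iff) auto
    have "x = vertex m k"
    proof
      fix j show "x j = vertex m k j"
        using True z[of j] insert.prems(3)[of j] x_ext
        by (cases "j \<in> {1..m}") (auto simp: vertex_def extensional_def)
    qed
    then show ?thesis using True z insert.hyps by simp
  next
    case False
    have "0 \<le> (\<Sum>j\<in>S. x j)" using S x0 by (intro sum_nonneg) auto
    with False tot have lt: "x k < 1" by simp
    define y where "y = (\<lambda>j\<in>{1..m}. if j \<in> S then x j / (1 - x k) else 0)"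
    have "(\<Sum>j=1..m. y j) = (\<Sum>j\<in>S. x j / (1 - x k))"
      unfolding y_def by (rule sum.mono_neutral_cong_right) (use S in auto)
    also have "\<dots> = 1" using tot lt by (simp flip: sum_divide_distrib add: field_simps)
    finally have y: "y \<in> prob_simplex m"
      using lt x0 by (auto simp: prob_simplex_def y_def)
    have fy: "f y = (\<Sum>j\<in>S. y j * f (vertex m j))"
      using S y by (rule insert.IH) (auto simp: y_def)
    have comb: "x = (\<lambda>j\<in>{1..m}. (1 - x k) * y j + x k * vertex m k j)"
    proof
      fix j
      show "x j = (\<lambda>j\<in>{1..m}. (1 - x k) * y j + x k * vertex m k j) j"
        using insert.prems(3)[of j] x_ext lt insert.hyps(2)
        by (cases "j \<in> {1..m}") (auto simp: y_def vertex_def extensional_def)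
    qed
    have "f (\<lambda>j\<in>{1..m}. (1 - x k) * y j + x k * vertex m k j)
        = (1 - x k) * f y + x k * f (vertex m k)"
      using f y vertex_in_prob_simplex[OF k] x0[OF k] lt
      by (simp add: affine_on_simplex_def)
    then have "f x = (1 - x k) * f y + x k * f (vertex m k)"
      using comb by simp
    also have "(1 - x k) * f y = (\<Sum>j\<in>S. x j * f (vertex m j))"
      unfolding fy sum_distrib_left
      by (rule sum.cong) (use S lt in \<open>auto simp: y_def\<close>)
    finally show ?thesis using insert.hyps by simp
  qed
qed

lemma affine_on_simplex_expand:
  assumes "affine_on_simplex m f" "x \<in> prob_simplex m"
  shows "f x = (\<Sum>j=1..m. x j * f (vertex m j))"
  using affine_on_simplex_expand_aux[OF assms(1) _ _ assms(2), of "{1..m}"] by simp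

text \<open>For each \<open>j\<close> the weights \<open>e i (vertex m j)\<close> are nonnegative
  and sum to 1 over \<open>i\<close>, so the resulting average of the \<open>p i j\<close> is at
  most their maximum. Guessing a maximiser at every vertex attains this bound.\<close>

lemma success_profile_eq:
  assumes fin: "finite H" and ne: "H \<noteq> {}" and p: "\<And>i. i \<in> H \<Longrightarrow> p i \<in> prob_simplex m"
  shows "success_profile m p H = (\<Sum>j=1..m. Max ((\<lambda>i. p i j) ` H))"
proof -
  let ?M = "\<lambda>j. Max ((\<lambda>i. p i j) ` H)"
  have "\<exists>i. i \<in> H \<and> p i j = ?M j" for j
    using Max_in[of "(\<lambda>i. p i j) ` H"] fin ne by fastforce
  then obtain g where g: "\<And>j. g j \<in> H" "\<And>j. p (g j) j = ?M j" by metis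
  have "(GREATEST s. \<exists>e. measurement m H e \<and> s = (\<Sum>i\<in>H. e i (p i))) = (\<Sum>j=1..m. ?M j)"
  proof (rule Greatest_equality)
    \<comment> \<open>Maximum-likelihood decision: on observing \<open>j\<close>, the answer is the
      maximiser \<open>g j\<close>.\<close>
    define e where "e i x = (\<Sum>j=1..m. if g j = i then x j else 0)" for i and x :: "nat \<Rightarrow> real"
    have swap: "(\<Sum>i\<in>H. e i (q i)) = (\<Sum>j=1..m. q (g j) j)" for q
      unfolding e_def by (subst sum.swap) (simp add: sum.delta' fin g(1))
    have "measurement m H e"
      unfolding measurement_def
    proof (intro conjI ballI)
      show "affine_on_simplex m (e i)" for i
        unfolding affine_on_simplex_def e_def
        by (auto simp: sum_distrib_left sum.distrib[symmetric] intro!: sum.cong)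
      show "0 \<le> e i x" if "x \<in> prob_simplex m" for i x
        using that by (auto simp: e_def prob_simplex_def intro!: sum_nonneg)
      show "(\<Sum>i\<in>H. e i x) = 1" if "x \<in> prob_simplex m" for x
        using that swap[of "\<lambda>_. x"] by (simp add: prob_simplex_def)
    qed
    moreover have "(\<Sum>j=1..m. ?M j) = (\<Sum>i\<in>H. e i (p i))"
      unfolding swap[of p] g(2) ..
    ultimately show "\<exists>e. measurement m H e \<and> (\<Sum>j=1..m. ?M j) = (\<Sum>i\<in>H. e i (p i))" by blast
  next
    fix s assume "\<exists>e. measurement m H e \<and> s = (\<Sum>i\<in>H. e i (p i))"
    then obtain e where e: "measurement m H e" and s: "s = (\<Sum>i\<in>H. e i (p i))" by blast
    have "s = (\<Sum>i\<in>H. \<Sum>j=1..m. p i j * e i (vertex m j))"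
      unfolding s using e p
      by (intro sum.cong affine_on_simplex_expand) (auto simp: measurement_def)
    also have "\<dots> = (\<Sum>j=1..m. \<Sum>i\<in>H. p i j * e i (vertex m j))" by (rule sum.swap)
    also have "\<dots> \<le> (\<Sum>j=1..m. \<Sum>i\<in>H. ?M j * e i (vertex m j))"
      using e fin vertex_in_prob_simplex
      by (intro sum_mono mult_right_mono Max_ge) (auto simp: measurement_def)
    also have "\<dots> = (\<Sum>j=1..m. ?M j)"
      unfolding sum_distrib_left[symmetric] using e vertex_in_prob_simplex
      by (intro sum.cong) (auto simp: measurement_def)
    finally show "s \<le> (\<Sum>j=1..m. ?M j)" .
  qed
  then show ?thesis using ne by (simp add: success_profile_def)
qed

section \<open>Layer-cake decomposition of a maximum\<close>

text \<open>For nonempty \<open>B\<close> the set of levels is bounded. For \<open>B = {}\<close>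
  and finite \<open>I\<close> it is a half-line, to whose infinite length \<open>measure\<close>
  assigns 0.\<close>

definition layer :: "'a set \<Rightarrow> ('a \<Rightarrow> real) \<Rightarrow> 'a set \<Rightarrow> real" where
  "layer I x B = measure lborel {t. 0 \<le> t \<and> {i\<in>I. t < x i} = B}"

lemma layer_nonneg: "0 \<le> layer I x B"
  by (simp add: layer_def)

text \<open>The levels \<open>t \<ge> 0\<close> at which some \<open>i\<close> in \<open>H\<close>
  satisfies \<open>t < x i\<close> fill the interval from 0 to the maximum over \<open>H\<close>.
  Distinct \<open>B\<close> give disjoint sets of levels, so their lengths add up to the length of
  that interval.\<close>

lemma sum_layer_eq_Max:
  assumes fin: "finite I" and HI: "H \<subseteq> I" and ne: "H \<noteq> {}" and x: "\<And>i. i \<in> I \<Longrightarrow> 0 \<le> x i"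
  shows "(\<Sum>B | B \<subseteq> I \<and> B \<inter> H \<noteq> {}. layer I x B) = Max (x ` H)"
proof -
  let ?L = "\<lambda>B. {t::real. 0 \<le> t \<and> {i\<in>I. t < x i} = B}"
  let ?S = "{B. B \<subseteq> I \<and> B \<inter> H \<noteq> {}}"
  let ?M = "Max (x ` H)"
  have finH: "finite H" using fin HI finite_subset by blast
  have M: "t < ?M \<longleftrightarrow> (\<exists>i\<in>H. t < x i)" for t
    using finH ne by (subst Max_gr_iff) auto
  have M0: "0 \<le> ?M" using finH ne HI x by (auto simp: Max_ge_iff)
  have un: "(\<Union>B\<in>?S. ?L B) = {0..<?M}"
    using HI by (fastforce simp: M)
  have meas: "?L B \<in> sets lborel" if "B \<subseteq> I" for B
  proof -
    have "?L B = {t \<in> space borel. 0 \<le> t \<and> (\<forall>i\<in>I. t < x i \<longleftrightarrow> i \<in> B)}"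
      using that by auto
    also have "\<dots> \<in> sets borel"
      using fin by measurable
    finally show ?thesis by simp
  qed
  have "measure lborel (\<Union>B\<in>?S. ?L B) = (\<Sum>B\<in>?S. measure lborel (?L B))"
  proof (rule measure_finite_Union)
    show "finite ?S" using fin by simp
    show "?L ` ?S \<subseteq> sets lborel" using meas by auto
    show "disjoint_family_on ?L ?S" by (auto simp: disjoint_family_on_def)
    \<comment> \<open>Additivity of \<open>measure\<close> needs pieces of finite length; each piece
      lies in the bounded interval because \<open>B\<close> meets \<open>H\<close>.\<close>
    fix B assume B: "B \<in> ?S"
    then have "emeasure lborel (?L B) \<le> emeasure lborel {0..<?M}"
      using un by (intro emeasure_mono) auto
    then show "emeasure lborel (?L B) \<noteq> \<infinity>"
      using M0 by (auto simp: top_unique)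
  qed
  then show ?thesis using M0 unfolding un layer_def by simp
qed

section \<open>Success profiles of classical states and the functions \<open>theta\<close>\<close>

lemma theta_singleton: "theta n c {i} = (\<Sum>B | B \<subseteq> {1..n} \<and> i \<in> B. c B)"
  unfolding theta_def by (rule sum.cong) auto

lemma theta_cong:
  assumes "\<And>B. B \<subseteq> {1..n} \<Longrightarrow> B \<noteq> {} \<Longrightarrow> c B = d B"
  shows "theta n c H = theta n d H"
  unfolding theta_def using assms by (intro sum.cong) auto

text \<open>The layers are taken vertex by vertex and summed. Normalisation of \<open>c\<close> is
  the case \<open>H = {i}\<close>, where the sum of the maxima is the total mass of
  \<open>p i\<close>.\<close>

lemma success_profile_is_theta:
  assumes p: "\<And>i. i \<in> {1..n} \<Longrightarrow> p i \<in> prob_simplex m"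
  obtains c where "c \<in> coefficient_polytope n"
    and "\<And>H. H \<subseteq> {1..n} \<Longrightarrow> success_profile m p H = theta n c H"
proof
  define d where "d B = (\<Sum>j=1..m. layer {1..n} (\<lambda>i. p i j) B)" for B
  define c where "c = restrict d (Pow {1..n} - {{}})"
  have d: "theta n d H = (\<Sum>j=1..m. Max ((\<lambda>i. p i j) ` H))" if "H \<subseteq> {1..n}" "H \<noteq> {}" for H
  proof -
    have "theta n d H = (\<Sum>j=1..m. \<Sum>B | B \<subseteq> {1..n} \<and> B \<inter> H \<noteq> {}. layer {1..n} (\<lambda>i. p i j) B)"
      unfolding theta_def d_def by (rule sum.swap)
    also have "\<dots> = (\<Sum>j=1..m. Max ((\<lambda>i. p i j) ` H))"
      using that p by (intro sum.cong sum_layer_eq_Max) (auto simp: prob_simplex_def)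
    finally show ?thesis .
  qed
  \<comment> \<open>A set meeting \<open>H\<close> is nonempty, so restricting \<open>d\<close> to
    nonempty sets leaves \<open>theta\<close> unchanged.\<close>
  have cd: "theta n c H = theta n d H" for H
    by (rule theta_cong) (simp add: c_def)
  show "success_profile m p H = theta n c H" if "H \<subseteq> {1..n}" for H
  proof (cases "H = {}")
    case True
    then show ?thesis by (simp add: success_profile_def theta_def)
  next
    case False
    with that have "success_profile m p H = (\<Sum>j=1..m. Max ((\<lambda>i. p i j) ` H))"
      using p by (intro success_profile_eq) (auto intro: finite_subset)
    then show ?thesis using d that False cd by simp
  qed
  have "theta n c {i} = 1" if "i \<in> {1..n}" for i
    using d[of "{i}"] p[OF that] that by (simp add: cd prob_simplex_def)
  moreover have "0 \<le> c B" if "B \<in> Pow {1..n} - {{}}" for B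
    using that by (simp add: c_def d_def sum_nonneg layer_nonneg)
  moreover have "c \<in> extensional (Pow {1..n} - {{}})"
    by (simp add: c_def)
  ultimately show "c \<in> coefficient_polytope n"
    unfolding coefficient_polytope_def using theta_singleton by simp
qed

text \<open>At the vertex numbered \<open>j\<close> the entries \<open>p i j\<close> take only the
  values 0 and \<open>c (b j)\<close>, so the maximum over \<open>H\<close> detects whether
  \<open>b j\<close> meets \<open>H\<close>. The equations of the polytope say that each
  \<open>p i\<close> has mass 1, and \<open>1 \<le> n\<close> provides at least one vertex.\<close>

lemma theta_is_success_profile:
  assumes c: "c \<in> coefficient_polytope n" and n: "1 \<le> n"
  obtains m p where "1 \<le> m" "\<And>i. i \<in> {1..n} \<Longrightarrow> p i \<in> prob_simplex m"
    and "\<And>H. H \<subseteq> {1..n} \<Longrightarrow> success_profile m p H = theta n c H"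
proof -
  let ?P = "Pow {1..n} - {{}}"
  define m where "m = card ?P"
  have finP: "finite ?P" by simp
  then obtain b where b: "bij_betw b {1..m} ?P"
    using ex_bij_betw_nat_finite_1 unfolding m_def by blast
  have bP: "b j \<in> ?P" if "j \<in> {1..m}" for j
    using b that by (rule bij_betw_apply)
  have c0: "\<And>B. B \<in> ?P \<Longrightarrow> 0 \<le> c B"
    and c1: "\<And>i. i \<in> {1..n} \<Longrightarrow> (\<Sum>B | B \<subseteq> {1..n} \<and> i \<in> B. c B) = 1"
    using c by (auto simp: coefficient_polytope_def)
  define p where "p i = (\<lambda>j\<in>{1..m}. if i \<in> b j then c (b j) else 0)" for i
  have sum_b: "(\<Sum>j=1..m. if b j \<inter> H \<noteq> {} then c (b j) else 0) = theta n c H" for H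
  proof -
    have "(\<Sum>j=1..m. if b j \<inter> H \<noteq> {} then c (b j) else 0)
        = (\<Sum>B\<in>?P. if B \<inter> H \<noteq> {} then c B else 0)"
      using b by (rule sum.reindex_bij_betw)
    also have "\<dots> = theta n c H"
      unfolding theta_def by (rule sum.mono_neutral_cong_right) auto
    finally show ?thesis .
  qed
  have p: "p i \<in> prob_simplex m" if i: "i \<in> {1..n}" for i
  proof -
    have "(\<Sum>j=1..m. p i j) = theta n c {i}"
      unfolding sum_b[symmetric] by (rule sum.cong) (auto simp: p_def)
    then show ?thesis
      using c1[OF i] theta_singleton[of n c i] c0 bP by (auto simp: prob_simplex_def p_def)
  qed
  have "success_profile m p H = theta n c H" if H: "H \<subseteq> {1..n}" for H
  proof (cases "H = {}")
    case True
    then show ?thesis by (simp add: success_profile_def theta_def)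
  next
    case False
    have finH: "finite H" using H finite_subset by blast
    have "success_profile m p H = (\<Sum>j=1..m. Max ((\<lambda>i. p i j) ` H))"
      using False H p finH by (intro success_profile_eq) auto
    also have "\<dots> = (\<Sum>j=1..m. if b j \<inter> H \<noteq> {} then c (b j) else 0)"
    proof (rule sum.cong[OF refl])
      fix j assume j: "j \<in> {1..m}"
      \<comment> \<open>If only part of \<open>H\<close> lies in \<open>b j\<close>, some entries
        are 0; nonnegativity of \<open>c\<close> keeps \<open>c (b j)\<close> the maximum.\<close>
      show "Max ((\<lambda>i. p i j) ` H) = (if b j \<inter> H \<noteq> {} then c (b j) else 0)"
        using c0[OF bP[OF j]] j finH False
        by (intro Max_eqI) (auto simp: p_def image_iff)
    qed
    finally show ?thesis using sum_b by simp
  qed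
  moreover have "{1} \<in> ?P" using n by simp
  then have "1 \<le> m" unfolding m_def using finP
    by (metis One_nat_def Suc_leI card_gt_0_iff empty_iff)
  ultimately show thesis using that p by blast
qed

section \<open>Moebius inversion and recovery of the coefficients from error coordinates\<close>

text \<open>The exponent has the parity of \<open>card B - card A\<close>, and as a sum it splits by
  \<open>power_add\<close>.\<close>

definition mobius :: "('a set \<Rightarrow> real) \<Rightarrow> 'a set \<Rightarrow> real" where
  "mobius g B = (\<Sum>A\<in>Pow B. (- 1) ^ (card B + card A) * g A)"

lemma mobius_eq: "mobius g B = (- 1) ^ card B * (\<Sum>A\<in>Pow B. (- 1) ^ card A * g A)"
  by (simp add: mobius_def sum_distrib_left power_add mult.assoc)

text \<open>The signed subset-sum transform is an involution, and summing \<open>mobius g\<close>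
  over \<open>Pow S\<close> applies it twice to \<open>g\<close>.\<close>

lemma sum_mobius:
  assumes "finite S"
  shows "(\<Sum>B\<in>Pow S. mobius g B) = g S"
  unfolding mobius_eq
  using inclusion_exclusion_symmetric[of "\<lambda>S. \<Sum>A\<in>Pow S. (- 1) ^ card A * g A" g S] assms
  by simp

lemma mobius_of_sum:
  assumes "\<And>S. finite S \<Longrightarrow> g S = (\<Sum>B\<in>Pow S. f B)" "finite S"
  shows "mobius g S = f S"
  using inclusion_exclusion_mobius[of g f S] assms
  by (simp add: mobius_def card_mono neg_one_power_add_eq_neg_one_power_diff)

text \<open>
  Error coordinates omit the sets with at most one element, whose success value is forced to be
  their cardinality.
\<close>

definition success_of_error :: "(nat set \<Rightarrow> real) \<Rightarrow> nat set \<Rightarrow> real" where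
  "success_of_error x H = real (card H) - (if 2 \<le> card H then x H else 0)"

text \<open>
  At the error coordinates of \<open>c\<close> this is the sum of \<open>c B\<close> over the nonempty subsets \<open>B\<close> of \<open>A\<close>, so that
  \<open>c\<close> is recovered by Moebius inversion.
\<close>

definition subset_mass :: "nat \<Rightarrow> (nat set \<Rightarrow> real) \<Rightarrow> nat set \<Rightarrow> real" where
  "subset_mass n x A = success_of_error x {1..n} - success_of_error x ({1..n} - A)"

text \<open>Sets that avoid the complement of \<open>S\<close> are contained in \<open>S\<close>. So
  a difference of sums over sets meeting something becomes a sum over subsets, to which Moebius
  inversion applies.\<close>

lemma theta_diff:
  "theta n c {1..n} - theta n c ({1..n} - S) = (\<Sum>B | B \<subseteq> {1..n} \<and> B \<subseteq> S \<and> B \<noteq> {}. c B)"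
proof -
  let ?U = "{B. B \<subseteq> {1..n} \<and> B \<inter> {1..n} \<noteq> {}}"
  let ?V = "{B. B \<subseteq> {1..n} \<and> B \<inter> ({1..n} - S) \<noteq> {}}"
  have "sum c ?U - sum c ?V = sum c (?U - ?V)"
    by (rule sum_diff[symmetric]) auto
  also have "?U - ?V = {B. B \<subseteq> {1..n} \<and> B \<subseteq> S \<and> B \<noteq> {}}" by auto
  finally show ?thesis by (simp add: theta_def)
qed

text \<open>Below size 2 nothing is read from the coordinates: \<open>theta\<close> is 0 at the
  empty set, and the polytope equations make it 1 at singletons.\<close>

lemma success_of_error_coeff_error:
  assumes c: "c \<in> coefficient_polytope n" and H: "H \<subseteq> {1..n}"
  shows "success_of_error (\<lambda>H\<in>error_coords n. coeff_error n c H) H = theta n c H"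
proof -
  have fin: "finite H" using H finite_subset by blast
  consider "H = {}" | i where "H = {i}" "i \<in> {1..n}" | "2 \<le> card H"
  proof -
    have "card H = 0 \<or> card H = 1 \<or> 2 \<le> card H" by linarith
    then show thesis using that fin H by (auto simp: card_1_singleton_iff)
  qed
  then show ?thesis
  proof cases
    case 1
    then show ?thesis by (simp add: success_of_error_def theta_def)
  next
    case 2
    then have "theta n c H = 1"
      using c theta_singleton[of n c i] by (simp add: coefficient_polytope_def)
    with 2 show ?thesis by (simp add: success_of_error_def)
  next
    case 3
    with H show ?thesis by (simp add: success_of_error_def error_coords_def coeff_error_def)
  qed
qed

lemma mobius_subset_mass_coeff_error:
  assumes c: "c \<in> coefficient_polytope n" and B: "B \<subseteq> {1..n}" "B \<noteq> {}"
  shows "mobius (subset_mass n (\<lambda>H\<in>error_coords n. coeff_error n c H)) B = c B"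
proof -
  \<comment> \<open>Extension of \<open>c\<close> by zero: \<open>mobius_of_sum\<close> asks for the
    subset-sum identity at every finite set, including sets not contained in
    \<open>{1..n}\<close>.\<close>
  define f where "f B = (if B \<subseteq> {1..n} \<and> B \<noteq> {} then c B else 0)" for B
  have "mobius (subset_mass n (\<lambda>H\<in>error_coords n. coeff_error n c H)) B = f B"
  proof (rule mobius_of_sum)
    show "finite B" using B finite_subset by blast
    fix S :: "nat set" assume "finite S"
    have "subset_mass n (\<lambda>H\<in>error_coords n. coeff_error n c H) S
        = theta n c {1..n} - theta n c ({1..n} - S)"
      unfolding subset_mass_def by (simp only: success_of_error_coeff_error[OF c] Diff_subset subset_refl)
    also have "\<dots> = (\<Sum>B\<in>Pow S. f B)"
      unfolding theta_diff
      by (rule sum.mono_neutral_cong_left) (use \<open>finite S\<close> in \<open>auto simp: f_def\<close>)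
    finally show "subset_mass n (\<lambda>H\<in>error_coords n. coeff_error n c H) S = (\<Sum>B\<in>Pow S. f B)" .
  qed
  with B show ?thesis by (simp add: f_def)
qed

text \<open>The sets meeting \<open>H\<close> are those not contained in its complement, so the sum
  is the difference of \<open>subset_mass\<close> at \<open>{1..n}\<close> and at that complement.
  This leaves the success value at \<open>H\<close> minus that at the empty set, which is 0. Here
  \<open>x\<close> is arbitrary, not only an error vector of some \<open>c\<close>.\<close>

lemma theta_mobius_subset_mass:
  assumes H: "H \<subseteq> {1..n}"
  shows "theta n (mobius (subset_mass n x)) H = success_of_error x H"
proof -
  let ?f = "mobius (subset_mass n x)"
  have HH: "{1..n} - ({1..n} - H) = H" using H by blast
  have "theta n ?f H = sum ?f (Pow {1..n} - Pow ({1..n} - H))"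
    unfolding theta_def by (rule sum.cong) (use H in auto)
  also have "\<dots> = sum ?f (Pow {1..n}) - sum ?f (Pow ({1..n} - H))"
    by (rule sum_diff) auto
  also have "\<dots> = success_of_error x H"
    by (subst (1 2) sum_mobius) (simp_all only: subset_mass_def HH finite_atLeastAtMost finite_Diff
      Diff_cancel success_of_error_def, simp_all)
  finally show ?thesis .
qed

text \<open>Moebius inversion turns any \<open>x\<close> into a candidate \<open>c\<close>. Its
  normalising equations hold automatically, since \<open>success_of_error\<close> is 1 at singletons
  by construction; only nonnegativity remains as a condition on \<open>x\<close>.\<close>

lemma coeff_error_image_eq:
  "{(\<lambda>H\<in>error_coords n. coeff_error n c H) | c. c \<in> coefficient_polytope n}
    = {x \<in> extensional (error_coords n). \<forall>B\<in>Pow {1..n} - {{}}. 0 \<le> mobius (subset_mass n x) B}"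
  (is "?L = ?R")
proof
  show "?L \<subseteq> ?R"
  proof
    fix x assume "x \<in> ?L"
    then obtain c where x: "x = (\<lambda>H\<in>error_coords n. coeff_error n c H)"
      and c: "c \<in> coefficient_polytope n" by blast
    have "0 \<le> mobius (subset_mass n x) B" if "B \<in> Pow {1..n} - {{}}" for B
      using mobius_subset_mass_coeff_error[OF c, of B] that c
      by (simp add: x coefficient_polytope_def)
    then show "x \<in> ?R" unfolding x by simp
  qed
  show "?R \<subseteq> ?L"
  proof
    fix x assume x: "x \<in> ?R"
    define c where "c = restrict (mobius (subset_mass n x)) (Pow {1..n} - {{}})"
    have th: "theta n c H = success_of_error x H" if "H \<subseteq> {1..n}" for H
    proof -
      have "theta n c H = theta n (mobius (subset_mass n x)) H"
        by (rule theta_cong) (simp add: c_def)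
      with theta_mobius_subset_mass[OF that] show ?thesis by simp
    qed
    have "theta n c {i} = 1" if "i \<in> {1..n}" for i
      using th[of "{i}"] that by (simp add: success_of_error_def)
    moreover have "0 \<le> c B" if "B \<in> Pow {1..n} - {{}}" for B
      using that x by (simp add: c_def)
    moreover have "c \<in> extensional (Pow {1..n} - {{}})"
      by (simp add: c_def)
    ultimately have "c \<in> coefficient_polytope n"
      unfolding coefficient_polytope_def using theta_singleton by simp
    moreover have "x = (\<lambda>H\<in>error_coords n. coeff_error n c H)"
    proof
      fix H show "x H = (\<lambda>H\<in>error_coords n. coeff_error n c H) H"
        using x th[of H]
        by (cases "H \<in> error_coords n")
          (auto simp: extensional_def coeff_error_def error_coords_def success_of_error_def)
    qed
    ultimately show "x \<in> ?L" by blast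
  qed
qed

section \<open>Rational affine functions and rational polytopes\<close>

text \<open>Coefficients are only asserted to exist: closure under sums, differences and rational
  multiples then makes the Moebius expressions rational without computing them.\<close>

definition rational_affine :: "'i set \<Rightarrow> (('i \<Rightarrow> real) \<Rightarrow> real) \<Rightarrow> bool" where
  "rational_affine I f \<longleftrightarrow>
    (\<exists>a b. \<forall>x. f x = (\<Sum>i\<in>I. of_rat (a i) * x i) + of_rat b)"

lemma rational_affine_const: "rational_affine I (\<lambda>_. of_rat r)"
  unfolding rational_affine_def by (intro exI[of _ "\<lambda>_. 0"] exI[of _ r]) simp

lemma rational_affine_coord:
  assumes "finite I" "k \<in> I"
  shows "rational_affine I (\<lambda>x. x k)"
  unfolding rational_affine_def
  by (intro exI[of _ "\<lambda>i. if i = k then 1 else 0"] exI[of _ 0])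
    (use assms in \<open>simp add: if_distrib[of of_rat] if_distrib[of "\<lambda>r. r * _"] cong: if_cong\<close>)

lemma rational_affine_add:
  assumes "rational_affine I f" "rational_affine I g"
  shows "rational_affine I (\<lambda>x. f x + g x)"
proof -
  obtain a b a' b' where "\<And>x. f x = (\<Sum>i\<in>I. of_rat (a i) * x i) + of_rat b"
    "\<And>x. g x = (\<Sum>i\<in>I. of_rat (a' i) * x i) + of_rat b'"
    using assms unfolding rational_affine_def by metis
  then show ?thesis unfolding rational_affine_def
    by (intro exI[of _ "\<lambda>i. a i + a' i"] exI[of _ "b + b'"])
      (simp add: of_rat_add distrib_right sum.distrib)
qed

lemma rational_affine_scale:
  assumes "rational_affine I f"
  shows "rational_affine I (\<lambda>x. of_rat r * f x)"
proof -
  obtain a b where "\<And>x. f x = (\<Sum>i\<in>I. of_rat (a i) * x i) + of_rat b"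
    using assms unfolding rational_affine_def by metis
  then show ?thesis unfolding rational_affine_def
    by (intro exI[of _ "\<lambda>i. r * a i"] exI[of _ "r * b"])
      (simp add: of_rat_mult distrib_left sum_distrib_left mult.assoc)
qed

lemma rational_affine_diff:
  assumes "rational_affine I f" "rational_affine I g"
  shows "rational_affine I (\<lambda>x. f x - g x)"
  using rational_affine_add[OF assms(1) rational_affine_scale[OF assms(2), of "- 1"]]
  by (simp add: of_rat_minus)

lemma rational_affine_sum:
  assumes "\<And>k. k \<in> K \<Longrightarrow> rational_affine I (f k)"
  shows "rational_affine I (\<lambda>x. \<Sum>k\<in>K. f k x)"
  using assms
proof (induction K rule: infinite_finite_induct)
  case (insert k K)
  then show ?case using rational_affine_add[of I "f k"] by simp
qed (use rational_affine_const[of I 0] in simp_all)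

lemma rational_affine_mobius:
  assumes "\<And>A. A \<subseteq> B \<Longrightarrow> rational_affine I (\<lambda>x. g x A)"
  shows "rational_affine I (\<lambda>x. mobius (g x) B)"
  unfolding mobius_def
proof (rule rational_affine_sum)
  fix A assume "A \<in> Pow B"
  then show "rational_affine I (\<lambda>x. (- 1) ^ (card B + card A) * g x A)"
    using rational_affine_scale[OF assms, of A "(- 1) ^ (card B + card A)"]
    by (simp add: of_rat_power of_rat_minus)
qed

lemma finite_error_coords: "finite (error_coords n)"
  by (rule finite_subset[of _ "Pow {1..n}"]) (auto simp: error_coords_def)

lemma rational_affine_subset_mass: "rational_affine (error_coords n) (\<lambda>x. subset_mass n x A)"
proof -
  have "rational_affine (error_coords n) (\<lambda>x. success_of_error x H)" if "H \<subseteq> {1..n}" for H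
  proof -
    have "rational_affine (error_coords n) (\<lambda>x. if 2 \<le> card H then x H else 0)"
      using rational_affine_coord[OF finite_error_coords, of H n] that
        rational_affine_const[of "error_coords n" 0]
      by (cases "2 \<le> card H") (simp_all add: error_coords_def)
    then show ?thesis
      unfolding success_of_error_def
      using rational_affine_diff[OF rational_affine_const[of "error_coords n" "of_nat (card H)"]]
      by simp
  qed
  then show ?thesis
    unfolding subset_mass_def by (intro rational_affine_diff) auto
qed

text \<open>Negating the linear part brings \<open>0 \<le> f k x\<close> into the form used by
  \<open>rational_polytope\<close>, with the constant term as right-hand side.\<close>

lemma rational_polytopeI:
  assumes "finite I" "finite K" "\<And>i. i \<in> I \<Longrightarrow> bounded ((\<lambda>x. x i) ` S)"
    and f: "\<And>k. k \<in> K \<Longrightarrow> rational_affine I (f k)"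
    and S: "S = {x \<in> extensional I. \<forall>k\<in>K. 0 \<le> f k x}"
  shows "rational_polytope I S"
proof -
  have "\<forall>k\<in>K. \<exists>a b. \<forall>x. f k x = (\<Sum>i\<in>I. of_rat (a i) * x i) + of_rat b"
    using f unfolding rational_affine_def by blast
  then obtain a b where ab: "\<And>k x. k \<in> K \<Longrightarrow> f k x = (\<Sum>i\<in>I. of_rat (a k i) * x i) + of_rat (b k)"
    by metis
  have "0 \<le> f k x \<longleftrightarrow> (\<Sum>i\<in>I. of_rat (- a k i) * x i) \<le> of_rat (b k)" if "k \<in> K" for k x
    using ab[OF that, of x] by (simp add: of_rat_minus sum_negf) linarith
  then have "S = {x \<in> extensional I. \<forall>(a, b)\<in>(\<lambda>k. (\<lambda>i. - a k i, b k)) ` K.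
      (\<Sum>i\<in>I. of_rat (a i) * x i) \<le> of_rat b}"
    unfolding S by auto
  with assms show ?thesis unfolding rational_polytope_def by blast
qed

text \<open>Each \<open>c B\<close> with nonempty \<open>B\<close> is one nonnegative summand of a
  normalising sum, hence at most 1.\<close>

lemma bounded_coeff_error:
  "bounded ((\<lambda>c. coeff_error n c H) ` coefficient_polytope n)"
proof (rule boundedI)
  fix y assume "y \<in> (\<lambda>c. coeff_error n c H) ` coefficient_polytope n"
  then obtain c where c: "c \<in> coefficient_polytope n" and y: "y = coeff_error n c H" by blast
  have c01: "0 \<le> c B \<and> c B \<le> 1" if B: "B \<subseteq> {1..n}" "B \<noteq> {}" for B
  proof -
    obtain i where i: "i \<in> B" using B by blast
    have "c B \<le> (\<Sum>B | B \<subseteq> {1..n} \<and> i \<in> B. c B)"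
      using B i c by (intro member_le_sum) (auto simp: coefficient_polytope_def)
    also have "\<dots> = 1" using c B i by (auto simp: coefficient_polytope_def)
    finally show ?thesis using c B by (auto simp: coefficient_polytope_def)
  qed
  have "0 \<le> theta n c H"
    unfolding theta_def using c01 by (intro sum_nonneg) auto
  moreover have "theta n c H \<le> (\<Sum>B | B \<subseteq> {1..n} \<and> B \<inter> H \<noteq> {}. 1)"
    unfolding theta_def using c01 by (intro sum_mono) auto
  ultimately show "norm y \<le> real (card H) + (\<Sum>B | B \<subseteq> {1..n} \<and> B \<inter> H \<noteq> {}. 1)"
    unfolding y coeff_error_def by simp
qed

theorem corollary3p2:
  fixes n :: nat
  assumes "2 \<le> n"
  shows "classical_region n =
           {(\<lambda>H\<in>error_coords n. coeff_error n c H) | c. c \<in> coefficient_polytope n}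
       \<and> classical_success_profiles n =
           {(\<lambda>H\<in>Pow {1..n}. theta n c H) | c. c \<in> coefficient_polytope n}
       \<and> rational_polytope (error_coords n) (classical_region n)"
proof (intro conjI)
  have n: "1 \<le> n" using assms by simp
  show "classical_success_profiles n =
      {(\<lambda>H\<in>Pow {1..n}. theta n c H) | c. c \<in> coefficient_polytope n}" (is "?L = ?R")
  proof
    show "?L \<subseteq> ?R"
    proof
      fix x assume "x \<in> ?L"
      then obtain m p where x: "x = (\<lambda>H\<in>Pow {1..n}. success_profile m p H)"
        and p: "\<And>i. i \<in> {1..n} \<Longrightarrow> p i \<in> prob_simplex m"
        unfolding classical_success_profiles_def by blast
      obtain c where c: "c \<in> coefficient_polytope n"
        "\<And>H. H \<subseteq> {1..n} \<Longrightarrow> success_profile m p H = theta n c H"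
        using success_profile_is_theta[of n p m] p by blast
      then have "x = (\<lambda>H\<in>Pow {1..n}. theta n c H)"
        unfolding x by (intro restrict_ext) simp
      with c(1) show "x \<in> ?R" by blast
    qed
    show "?R \<subseteq> ?L"
    proof
      fix x assume "x \<in> ?R"
      then obtain c where x: "x = (\<lambda>H\<in>Pow {1..n}. theta n c H)"
        and c: "c \<in> coefficient_polytope n" by blast
      obtain m p where mp: "1 \<le> m" "\<And>i. i \<in> {1..n} \<Longrightarrow> p i \<in> prob_simplex m"
        "\<And>H. H \<subseteq> {1..n} \<Longrightarrow> success_profile m p H = theta n c H"
        using theta_is_success_profile[OF c n] by blast
      then have "x = (\<lambda>H\<in>Pow {1..n}. success_profile m p H)"
        unfolding x by (intro restrict_ext) simp
      with mp show "x \<in> ?L" unfolding classical_success_profiles_def by blast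
    qed
  qed
  show region: "classical_region n =
      {(\<lambda>H\<in>error_coords n. coeff_error n c H) | c. c \<in> coefficient_polytope n}" (is "?L = ?R")
  proof
    show "?L \<subseteq> ?R"
    proof
      fix x assume "x \<in> ?L"
      then obtain m p where x: "x = (\<lambda>H\<in>error_coords n. error_profile m p H)"
        and p: "\<And>i. i \<in> {1..n} \<Longrightarrow> p i \<in> prob_simplex m"
        unfolding classical_region_def by blast
      obtain c where c: "c \<in> coefficient_polytope n"
        "\<And>H. H \<subseteq> {1..n} \<Longrightarrow> success_profile m p H = theta n c H"
        using success_profile_is_theta[of n p m] p by blast
      then have "x = (\<lambda>H\<in>error_coords n. coeff_error n c H)"
        unfolding x
        by (intro restrict_ext) (simp add: error_coords_def error_profile_def coeff_error_def)
      with c(1) show "x \<in> ?R" by blast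
    qed
    show "?R \<subseteq> ?L"
    proof
      fix x assume "x \<in> ?R"
      then obtain c where x: "x = (\<lambda>H\<in>error_coords n. coeff_error n c H)"
        and c: "c \<in> coefficient_polytope n" by blast
      obtain m p where mp: "1 \<le> m" "\<And>i. i \<in> {1..n} \<Longrightarrow> p i \<in> prob_simplex m"
        "\<And>H. H \<subseteq> {1..n} \<Longrightarrow> success_profile m p H = theta n c H"
        using theta_is_success_profile[OF c n] by blast
      then have "x = (\<lambda>H\<in>error_coords n. error_profile m p H)"
        unfolding x
        by (intro restrict_ext) (simp add: error_coords_def error_profile_def coeff_error_def)
      with mp show "x \<in> ?L" unfolding classical_region_def by blast
    qed
  qed
  show "rational_polytope (error_coords n) (classical_region n)"
  proof (rule rational_polytopeI)
    \<comment> \<open>This description has no existential quantifier over \<open>c\<close>, so it is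
      already a finite system of inequalities in \<open>x\<close>.\<close>
    show "classical_region n = {x \<in> extensional (error_coords n).
        \<forall>B\<in>Pow {1..n} - {{}}. 0 \<le> mobius (subset_mass n x) B}"
      using region coeff_error_image_eq by simp
    show "rational_affine (error_coords n) (\<lambda>x. mobius (subset_mass n x) B)" for B
      by (rule rational_affine_mobius) (rule rational_affine_subset_mass)
    show "bounded ((\<lambda>x. x H) ` classical_region n)" if "H \<in> error_coords n" for H
    proof (rule bounded_subset)
      show "bounded ((\<lambda>c. coeff_error n c H) ` coefficient_polytope n)"
        by (rule bounded_coeff_error)
      show "(\<lambda>x. x H) ` classical_region n \<subseteq> (\<lambda>c. coeff_error n c H) ` coefficient_polytope n"
        using that by (auto simp: region)
    qed
  qed (simp_all add: finite_error_coords)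
qed

end
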